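(* The uniformity measure $I_U$ satisfies extremism monotonicity.
   Context: For $x,y\in\mathbb{R}^d$, $y$ dominates $x$ if $x_i\le y_i$ for all $i\in[d]$ and $x_j<y_j$ for some $j\in[d]$. A set of alternatives is a finite set $A\subseteq\mathbb{R}^d$ ($d\ge 1$ arbitrary) none of whose elements is dominated by another element of $A$. Let $\|x-y\|=\sum_{i=1}^d|x_i-y_i|$. For a finite nonempty set $S\subseteq\mathbb{R}^d$, $I_U(S)=\min_{x,y\in S,\,x\neq y}\|x-y\|$ ($+\infty$ if $|S|=1$; higher is better). For a finite set $B\subseteq\mathbb{R}^d$ and a positive integer $k$, $\mathcal{S}(I_U,B,k)$ is the set of all $S\subseteq B$ with $|S|=k$ maximizing $I_U(S)$ among the size-$k$ subsets of $B$. Extremism monotonicity of a measure $I$: for any set of alternatives $A$, $k\in\mathbb{N}$, $t>0$, and $S\in\mathcal{S}(I,A,k)$ with $x\in S$: if for some objective $i\in[d]$ we have $x_i=\max_{a\in A}a_i$ (resp. $x_i=\min_{a\in A}a_i$), then there exists $S'\in\mathcal{S}(I,(A\setminus\{x\})\cup\{x'\},k)$ with $x'\in S'$, where $x'_i:=x_i+t$ (resp. $x'_i:=x_i-t$) and $x'_j:=x_j$ for all $j\in[d]\setminus\{i\}$. *)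

theory Defs
  imports "HOL-Analysis.Analysis"
begin

definition dominates :: "real ^ 'd \<Rightarrow> real ^ 'd \<Rightarrow> bool" where
  "dominates y x \<longleftrightarrow> (\<forall>i. x $ i \<le> y $ i) \<and> (\<exists>j. x $ j < y $ j)"

definition set_of_alternatives :: "(real ^ 'd) set \<Rightarrow> bool" where
  "set_of_alternatives A \<longleftrightarrow> finite A \<and> (\<forall>x\<in>A. \<forall>y\<in>A - {x}. \<not> dominates y x)"

text \<open>The library's \<open>norm\<close> on \<open>real ^ 'd\<close> is Euclidean; distances here are
  Manhattan distances.\<close>

definition l1_norm :: "real ^ 'd \<Rightarrow> real" where
  "l1_norm x = (\<Sum>i\<in>UNIV. \<bar>x $ i\<bar>)"

text \<open>Only meaningful for finite nonempty \<open>S\<close>: \<open>Min\<close> is unspecified on the empty set.\<close>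

definition uniformity :: "(real ^ 'd) set \<Rightarrow> ereal" where
  "uniformity S =
    (if card S = 1 then \<infinity>
     else Min {ereal (l1_norm (x - y)) | x y. x \<in> S \<and> y \<in> S \<and> x \<noteq> y})"

definition optimal_subsets ::
    "((real ^ 'd) set \<Rightarrow> ereal) \<Rightarrow> (real ^ 'd) set \<Rightarrow> nat \<Rightarrow> (real ^ 'd) set set" where
  "optimal_subsets I B k = {S. is_arg_max I (\<lambda>T. T \<subseteq> B \<and> card T = k) S}"

definition shift_coord :: "'d \<Rightarrow> real \<Rightarrow> real ^ 'd \<Rightarrow> real ^ 'd" where
  "shift_coord i t x = (\<chi> j. if j = i then x $ i + t else x $ j)"

text \<open>For measures where higher is better. The modified set need not be a set of
  alternatives, as the shifted point may dominate, or be dominated by, other points.\<close>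

definition extremism_monotonicity :: "((real ^ 'd) set \<Rightarrow> ereal) \<Rightarrow> bool" where
  "extremism_monotonicity I \<longleftrightarrow>
    (\<forall>A k t S x i.
      set_of_alternatives A \<and> k > 0 \<and> t > 0 \<and> S \<in> optimal_subsets I A k \<and> x \<in> S \<longrightarrow>
      (x $ i = Max ((\<lambda>a. a $ i) ` A) \<longrightarrow>
        (\<exists>S' \<in> optimal_subsets I ((A - {x}) \<union> {shift_coord i t x}) k. shift_coord i t x \<in> S')) \<and>
      (x $ i = Min ((\<lambda>a. a $ i) ` A) \<longrightarrow>
        (\<exists>S' \<in> optimal_subsets I ((A - {x}) \<union> {shift_coord i (- t) x}) k.
          shift_coord i (- t) x \<in> S')))"

end

(* Moving an extreme point x outwards along its extremal coordinate i moves it away from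
   every other alternative in the Manhattan distance. Hence replacing x by the shifted point x'
   in an optimal S does not decrease the uniformity, and the result beats every candidate avoiding
   x', because such candidates already competed with S. So if an optimal subset of the
   modified set avoids x', then S with x replaced by x' is optimal too. *)
theory Submission
  imports Defs
begin

text \<open>Injectivity preserves the cardinality, so both sides fall in the same case of
  \<open>uniformity\<close>. Beyond singletons, every distance in the image bounds the distance of a
  preimage pair from above, and hence \<open>Min\<close> over the original distances.\<close>

lemma uniformity_image_mono:
  fixes S :: "(real ^ 'd) set" and f :: "real ^ 'd \<Rightarrow> real ^ 'd"
  assumes fin: "finite S" and ne: "S \<noteq> {}" and inj: "inj_on f S"
    and expand: "\<And>y z. y \<in> S \<Longrightarrow> z \<in> S \<Longrightarrow> l1_norm (y - z) \<le> l1_norm (f y - f z)"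
  shows "uniformity S \<le> uniformity (f ` S)"
proof (cases "card S = 1")
  case True
  then show ?thesis
    by (simp add: uniformity_def card_image[OF inj])
next
  case False
  define D where "D T = {ereal (l1_norm (x - y)) | x y. x \<in> T \<and> y \<in> T \<and> x \<noteq> y}"
    for T :: "(real ^ 'd) set"
  have fin_D: "finite (D T)" if "finite T" for T
    by (rule finite_subset[where B = "(\<lambda>(x, y). ereal (l1_norm (x - y))) ` (T \<times> T)"])
       (auto simp: D_def that)
  obtain x y where "x \<in> S" "y \<in> S" "x \<noteq> y"
    using False ne by (metis card_1_singleton_iff is_singletonI' is_singleton_def One_nat_def)
  \<comment> \<open>Injectivity keeps two distinct points distinct, so the second \<open>Min\<close>
    ranges over a nonempty set.\<close>
  then have ne_D: "D (f ` S) \<noteq> {}"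
    using inj by (fastforce simp: D_def dest: inj_onD)
  have "Min (D S) \<le> Min (D (f ` S))"
  proof (rule Min.boundedI[OF fin_D ne_D])
    fix d assume "d \<in> D (f ` S)"
    then obtain y z where yz: "y \<in> S" "z \<in> S" "f y \<noteq> f z" "d = ereal (l1_norm (f y - f z))"
      by (auto simp: D_def)
    then have "ereal (l1_norm (y - z)) \<in> D S"
      by (auto simp: D_def)
    then have "Min (D S) \<le> ereal (l1_norm (y - z))"
      by (simp add: fin_D fin)
    also have "\<dots> \<le> d"
      using expand yz by simp
    finally show "Min (D S) \<le> d" .
  qed (simp add: fin)
  then show ?thesis
    using False by (simp add: uniformity_def D_def card_image[OF inj])
qed

lemma optimal_subset_exists:
  fixes I :: "(real ^ 'd) set \<Rightarrow> ereal"
  assumes "finite B" "T \<subseteq> B" "card T = k"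
  obtains S where "S \<in> optimal_subsets I B k"
proof -
  have "finite {T. T \<subseteq> B \<and> card T = k}"
    using assms(1) by simp
  then have "finite (I ` {T. T \<subseteq> B \<and> card T = k})" "I ` {T. T \<subseteq> B \<and> card T = k} \<noteq> {}"
    using assms by auto
  from Max_in[OF this] obtain S where S: "S \<subseteq> B" "card S = k"
      "Max (I ` {T. T \<subseteq> B \<and> card T = k}) = I S"
    by auto
  have "I T \<le> I S" if "T \<subseteq> B" "card T = k" for T
    unfolding S(3)[symmetric] using that \<open>finite (I ` _)\<close> by (intro Max_ge) auto
  with S(1,2) have "S \<in> optimal_subsets I B k"
    by (simp add: optimal_subsets_def is_arg_max_def not_less)
  then show ?thesis
    by (rule that)
qed

text \<open>The hypothesis says that \<open>s\<close> and \<open>x $ i - a $ i\<close> never have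
  opposite signs, so adding \<open>s\<close> cannot shrink the absolute difference in coordinate
  \<open>i\<close>; the other coordinates stay fixed.\<close>

lemma l1_norm_shift_coord_ge:
  fixes x a :: "real ^ 'd::finite"
  assumes "0 \<le> s * (x $ i - a $ i)"
  shows "l1_norm (x - a) \<le> l1_norm (shift_coord i s x - a)"
  unfolding l1_norm_def
proof (rule sum_mono)
  fix j
  have "\<bar>x $ i - a $ i\<bar> \<le> \<bar>x $ i + s - a $ i\<bar>"
    using assms by (auto simp: zero_le_mult_iff)
  then show "\<bar>(x - a) $ j\<bar> \<le> \<bar>(shift_coord i s x - a) $ j\<bar>"
    by (simp add: shift_coord_def)
qed

lemma l1_norm_minus_commute: "l1_norm (x - y) = l1_norm (y - x)"
  by (simp add: l1_norm_def abs_minus_commute)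

text \<open>The sign of \<open>s\<close> covers both cases: a positive shift of a maximal coordinate and a
  negative shift of a minimal one.\<close>

lemma uniformity_optimal_shift_coord:
  fixes A :: "(real ^ 'd::finite) set"
  assumes fin: "finite A" and "s \<noteq> 0" and S: "S \<in> optimal_subsets uniformity A k" and "x \<in> S"
    and extreme: "\<And>a. a \<in> A \<Longrightarrow> 0 \<le> s * (x $ i - a $ i)"
  shows "\<exists>S' \<in> optimal_subsets uniformity ((A - {x}) \<union> {shift_coord i s x}) k.
    shift_coord i s x \<in> S'"
proof -
  define x' where "x' = shift_coord i s x"
  define A' where "A' = (A - {x}) \<union> {x'}"
  define f where "f = (\<lambda>y. if y = x then x' else y)"
  have SA: "S \<subseteq> A" and cS: "card S = k"
    and opt: "\<And>T. T \<subseteq> A \<Longrightarrow> card T = k \<Longrightarrow> uniformity T \<le> uniformity S"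
    using S by (auto simp: optimal_subsets_def is_arg_max_def not_less)
  \<comment> \<open>The shifted point lies strictly beyond the extreme value of coordinate
    \<open>i\<close>. Thus it cannot collide with another member of \<open>S\<close>, which makes
    \<open>f\<close> injective.\<close>
  have "x' \<notin> A"
  proof
    assume "x' \<in> A"
    from extreme[OF this] have "s * s \<le> 0"
      by (simp add: x'_def shift_coord_def)
    with \<open>s \<noteq> 0\<close> show False
      by (auto simp: mult_le_0_iff)
  qed
  then have inj: "inj_on f S"
    using SA by (auto simp: inj_on_def f_def)
  have expand: "l1_norm (x - a) \<le> l1_norm (x' - a)" if "a \<in> A" for a
    unfolding x'_def by (rule l1_norm_shift_coord_ge) (rule extreme[OF that])
  have le: "uniformity S \<le> uniformity (f ` S)"
  proof (rule uniformity_image_mono[OF _ _ inj])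
    fix y z assume "y \<in> S" "z \<in> S"
    with SA have "y \<in> A" "z \<in> A" by auto
    \<comment> \<open>The distance changes only if exactly one of the two points is
      \<open>x\<close>; symmetry of the distance then reduces the claim to
      \<open>expand\<close>.\<close>
    then show "l1_norm (y - z) \<le> l1_norm (f y - f z)"
      using expand[of y] expand[of z]
      by (simp add: f_def l1_norm_minus_commute[of y x] l1_norm_minus_commute[of y x'])
  qed (use fin SA \<open>x \<in> S\<close> in \<open>auto intro: finite_subset\<close>)
  have fS: "f ` S \<subseteq> A'" "card (f ` S) = k" "x' \<in> f ` S"
    using SA card_image[OF inj] cS \<open>x \<in> S\<close> by (fastforce simp: A'_def f_def, simp, force simp: f_def)
  obtain T where T: "T \<in> optimal_subsets uniformity A' k"
    using optimal_subset_exists[of A' "f ` S" k] fS fin by (auto simp: A'_def)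
  have "f ` S \<in> optimal_subsets uniformity A' k" if "x' \<notin> T"
  proof -
    \<comment> \<open>Avoiding \<open>x'\<close> puts \<open>T\<close> inside
      \<open>A - {x}\<close>, so \<open>T\<close> was already a competitor of \<open>S\<close> in
      the original problem.\<close>
    from T that have "T \<subseteq> A" "card T = k"
      by (auto simp: optimal_subsets_def is_arg_max_def A'_def)
    then have "uniformity T \<le> uniformity (f ` S)"
      using opt le order_trans by blast
    moreover have "uniformity U \<le> uniformity T" if "U \<subseteq> A'" "card U = k" for U
      using T that by (simp add: optimal_subsets_def is_arg_max_def not_less)
    ultimately have "uniformity U \<le> uniformity (f ` S)" if "U \<subseteq> A'" "card U = k" for U
      using that order_trans by blast
    with fS show ?thesis
      by (simp add: optimal_subsets_def is_arg_max_def not_less)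
  qed
  with T fS show ?thesis
    unfolding A'_def x'_def by blast
qed

theorem proposition17:
  "extremism_monotonicity (uniformity :: (real ^ 'd::finite) set \<Rightarrow> ereal)"
  unfolding extremism_monotonicity_def
proof (intro allI impI conjI; elim conjE)
  fix A :: "(real ^ 'd) set" and k t S x i
  assume "set_of_alternatives A"
  then have fin: "finite A"
    by (simp add: set_of_alternatives_def)
  assume "0 < (t::real)" and S: "S \<in> optimal_subsets uniformity A k" "x \<in> S"
  {
    assume "x $ i = Max ((\<lambda>a. a $ i) ` A)"
    then show "\<exists>S' \<in> optimal_subsets uniformity ((A - {x}) \<union> {shift_coord i t x}) k.
        shift_coord i t x \<in> S'"
      \<comment> \<open>Maximality gives \<open>x $ i - a $ i\<close> \<ge> 0 on \<open>A\<close>,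
        matching the sign of \<open>t\<close>; in the minimal case both signs flip.\<close>
      using fin \<open>0 < t\<close> by (intro uniformity_optimal_shift_coord[OF fin _ S]) auto
  next
    assume "x $ i = Min ((\<lambda>a. a $ i) ` A)"
    then show "\<exists>S' \<in> optimal_subsets uniformity ((A - {x}) \<union> {shift_coord i (- t) x}) k.
        shift_coord i (- t) x \<in> S'"
      using fin \<open>0 < t\<close>
      by (intro uniformity_optimal_shift_coord[OF fin _ S]) (auto simp: mult_le_0_iff)
  }
qed

end
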